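(* Let $\mathbb{F}$ be a field. For every $n\ge 1$ there are multilinear polynomials $f,g\in\mathbb{F}[x_{11},x_{12},\ldots,x_{nn}]$ (in $n^2$ commuting variables) such that both $f$ and $g$ have arithmetic formulas of size $O(n^2)$ and $f\circ g$ is the Permanent polynomial $$\mathrm{Perm}(x_{11},\ldots,x_{nn})=\sum_{\sigma\in S_n}\prod_{i=1}^n x_{i\sigma(i)}.$$ Furthermore, for $\mathbb{F}=\mathbb{Q}$ these formulas for $f$ and $g$ are monotone.
   Context: Hadamard product of commutative polynomials: for $f=\sum_m a_m m$ and $g=\sum_m b_m m$ in $\mathbb{F}[X]$ (sums over monomials $m$), $f\circ g=\sum_m a_m b_m m$. An arithmetic formula is an arithmetic circuit (with $+$ and $\times$ gates, inputs being variables or field constants) whose underlying graph is a tree. A formula over $\mathbb{Q}$ is monotone if all constants appearing in it are nonnegative. *)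

theory Defs
  imports Complex_Main "HOL-Library.Poly_Mapping" "HOL-Combinatorics.Permutations"
begin

text \<open>
  Polynomials in commuting variables indexed by \<open>'v\<close>: finitely supported maps from monomials
  (finitely supported exponent vectors) to coefficients, with the convolution product of
  \<^theory>\<open>HOL-Library.Poly_Mapping\<close>.
\<close>

type_synonym 'v monomial = "'v \<Rightarrow>\<^sub>0 nat"
type_synonym ('v, 'a) mpoly = "'v monomial \<Rightarrow>\<^sub>0 'a"

definition var_poly :: "'v \<Rightarrow> ('v, 'a::comm_semiring_1) mpoly" where
  "var_poly v = Poly_Mapping.single (Poly_Mapping.single v 1) 1"

definition const_poly :: "'a::comm_semiring_1 \<Rightarrow> ('v, 'a) mpoly" where
  "const_poly c = Poly_Mapping.single 0 c"

definition poly_vars :: "('v, 'a::zero) mpoly \<Rightarrow> 'v set" where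
  "poly_vars f = (\<Union>m \<in> Poly_Mapping.keys f. Poly_Mapping.keys m)"

definition multilinear :: "('v, 'a::zero) mpoly \<Rightarrow> bool" where
  "multilinear f \<longleftrightarrow> (\<forall>m \<in> Poly_Mapping.keys f. \<forall>v. Poly_Mapping.lookup m v \<le> 1)"

text \<open>
  Stated for arbitrary keys, because lifting at key type \<open>'v monomial\<close> would also unfold the monomials.
\<close>

lift_definition hadamard ::
    "('k \<Rightarrow>\<^sub>0 'a::mult_zero) \<Rightarrow> ('k \<Rightarrow>\<^sub>0 'a) \<Rightarrow> ('k \<Rightarrow>\<^sub>0 'a)" (infixl \<open>\<circ>\<^sub>H\<close> 70)
  is "\<lambda>f g m. f m * g m"
  by (rule rev_finite_subset) auto

text \<open>
  Since every element of a datatype is a tree, no gate output is ever shared. Gates have fan-in two;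
  size counts all nodes, input leaves included.
\<close>

datatype (formula_vars: 'v, formula_consts: 'a) formula =
    Var 'v
  | Const 'a
  | Plus "('v, 'a) formula" "('v, 'a) formula"
  | Times "('v, 'a) formula" "('v, 'a) formula"

primrec formula_poly :: "('v, 'a::comm_semiring_1) formula \<Rightarrow> ('v, 'a) mpoly" where
  "formula_poly (Var v) = var_poly v"
| "formula_poly (Const c) = const_poly c"
| "formula_poly (Plus \<phi> \<psi>) = formula_poly \<phi> + formula_poly \<psi>"
| "formula_poly (Times \<phi> \<psi>) = formula_poly \<phi> * formula_poly \<psi>"

primrec formula_size :: "('v, 'a) formula \<Rightarrow> nat" where
  "formula_size (Var v) = 1"
| "formula_size (Const c) = 1"
| "formula_size (Plus \<phi> \<psi>) = 1 + formula_size \<phi> + formula_size \<psi>"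
| "formula_size (Times \<phi> \<psi>) = 1 + formula_size \<phi> + formula_size \<psi>"

definition monotone_formula :: "('v, rat) formula \<Rightarrow> bool" where
  "monotone_formula \<phi> \<longleftrightarrow> (\<forall>c \<in> formula_consts \<phi>. 0 \<le> c)"

definition index_square :: "nat \<Rightarrow> (nat \<times> nat) set" where
  "index_square n = {1..n} \<times> {1..n}"

definition permanent_poly :: "nat \<Rightarrow> (nat \<times> nat, 'a::comm_semiring_1) mpoly" where
  "permanent_poly n = (\<Sum>\<sigma> | \<sigma> permutes {1..n}. \<Prod>i = 1..n. var_poly (i, \<sigma> i))"

end

theory Submission
  imports Defs
begin

text \<open>
  Take \<open>f\<close> as the product of the row sums and \<open>g\<close> as the product of the column sums of the matrix of
  variables. Expanding, \<open>f\<close> is the sum of the squarefree monomials that pick one entry in each row,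
  \<open>g\<close> the sum of those that pick one entry in each column, all with coefficient \<open>1\<close>. Their Hadamard
  product keeps the monomials occurring in both, which are those of the permutation matrices.
\<close>

section \<open>Squarefree polynomials as families of sets\<close>

text \<open>Encoding a squarefree monomial by its support turns comparison of monomials into
  comparison of sets.\<close>

definition set_monomial :: "'v set \<Rightarrow> 'v monomial" where
  "set_monomial S = (\<Sum>v\<in>S. Poly_Mapping.single v 1)"

definition family_poly :: "'v set set \<Rightarrow> ('v, 'a::comm_semiring_1) mpoly" where
  "family_poly A = (\<Sum>S\<in>A. \<Prod>v\<in>S. var_poly v)"

lemma lookup_set_monomial:
  "finite S \<Longrightarrow> Poly_Mapping.lookup (set_monomial S) v = (if v \<in> S then 1 else 0)"
  unfolding set_monomial_def
  by (induction S rule: finite_induct) (auto simp: lookup_add lookup_single when_def)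

lemma keys_set_monomial: "finite S \<Longrightarrow> Poly_Mapping.keys (set_monomial S) = S"
  by (auto simp: in_keys_iff lookup_set_monomial split: if_splits)

text \<open>The keys of the monomial give back the set. Finiteness matters: a sum over an infinite
  set defaults to 0, the monomial of the empty set.\<close>

lemma inj_on_set_monomial:
  assumes "\<And>S. S \<in> A \<Longrightarrow> finite S"
  shows "inj_on set_monomial A"
  using assms by (metis inj_onI keys_set_monomial)

lemma prod_var_poly:
  "finite S \<Longrightarrow>
    (\<Prod>v\<in>S. var_poly v) = Poly_Mapping.single (set_monomial S) (1::'a::comm_semiring_1)"
  unfolding set_monomial_def
  by (induction S rule: finite_induct) (auto simp: var_poly_def mult_single)

text \<open>Distinct sets have distinct monomials, so no like terms collect and the coefficients
  stay 0 or 1 in every characteristic.\<close>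

lemma lookup_family_poly:
  assumes "finite A" and "\<And>S. S \<in> A \<Longrightarrow> finite S"
  shows "Poly_Mapping.lookup (family_poly A :: ('v, 'a::comm_semiring_1) mpoly) m =
    (if m \<in> set_monomial ` A then 1 else 0)"
proof -
  have "(family_poly A :: ('v, 'a) mpoly) = (\<Sum>S\<in>A. Poly_Mapping.single (set_monomial S) 1)"
    unfolding family_poly_def by (rule sum.cong) (simp_all add: prod_var_poly assms)
  also have "\<dots> = (\<Sum>k\<in>set_monomial ` A. Poly_Mapping.single k 1)"
    by (simp add: sum.reindex inj_on_set_monomial assms)
  finally show ?thesis
    using assms(1) by (simp add: lookup_sum lookup_single when_def)
qed

lemma keys_family_poly:
  assumes "finite A" and "\<And>S. S \<in> A \<Longrightarrow> finite S"
  shows "Poly_Mapping.keys (family_poly A :: ('v, 'a::comm_semiring_1) mpoly) = set_monomial ` A"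
  by (auto simp: in_keys_iff lookup_family_poly assms split: if_splits)

lemma poly_vars_family_poly:
  assumes "finite A" and "\<And>S. S \<in> A \<Longrightarrow> finite S"
  shows "poly_vars (family_poly A :: ('v, 'a::comm_semiring_1) mpoly) = \<Union>A"
  using assms by (simp add: poly_vars_def keys_family_poly keys_set_monomial)

lemma multilinear_family_poly:
  assumes "finite A" and "\<And>S. S \<in> A \<Longrightarrow> finite S"
  shows "multilinear (family_poly A :: ('v, 'a::comm_semiring_1) mpoly)"
  using assms by (auto simp: multilinear_def keys_family_poly lookup_set_monomial)

text \<open>Coefficients 0 and 1 multiply like indicator functions, so the termwise product
  intersects the families.\<close>

lemma hadamard_family_poly:
  assumes "finite A" "finite B" and fin: "\<And>S. S \<in> A \<union> B \<Longrightarrow> finite S"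
  shows "family_poly A \<circ>\<^sub>H family_poly B =
    (family_poly (A \<inter> B) :: ('v, 'a::comm_semiring_1) mpoly)"
proof (rule poly_mapping_eqI)
  fix m
  \<comment> \<open>A monomial occurring for both families comes from a single set, by injectivity
    on \<open>A \<union> B\<close>.\<close>
  have "set_monomial ` (A \<inter> B) = set_monomial ` A \<inter> set_monomial ` B"
    by (rule inj_on_image_Int[of _ "A \<union> B"]) (auto intro: inj_on_set_monomial fin)
  moreover have "Poly_Mapping.lookup (family_poly (A \<inter> B) :: ('v, 'a) mpoly) m =
      (if m \<in> set_monomial ` (A \<inter> B) then 1 else 0)"
    by (rule lookup_family_poly) (use assms in auto)
  ultimately show "Poly_Mapping.lookup (family_poly A \<circ>\<^sub>H family_poly B) m =
      Poly_Mapping.lookup (family_poly (A \<inter> B) :: ('v, 'a) mpoly) m"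
    using assms by (simp add: hadamard.rep_eq lookup_family_poly)
qed

text \<open>The first injectivity makes each product squarefree, the second keeps different
  \<open>x\<close> from giving the same set. This form covers the expanded row and column products
  as well as the permanent.\<close>

lemma sum_prod_var_poly_eq_family_poly:
  assumes "\<And>x. x \<in> X \<Longrightarrow> inj_on (w x) I" and "inj_on (\<lambda>x. w x ` I) X"
  shows "(\<Sum>x\<in>X. \<Prod>i\<in>I. var_poly (w x i)) = family_poly ((\<lambda>x. w x ` I) ` X)"
  using assms by (simp add: family_poly_def sum.reindex prod.reindex)

section \<open>Choosing one entry from each line\<close>

text \<open>\<open>h\<close> carries the orientation: with \<open>Pair\<close> the index
  \<open>i\<close> runs over rows, with the swapped pair over columns.\<close>

definition choice_sets :: "('i \<Rightarrow> 'j \<Rightarrow> 'v) \<Rightarrow> 'i set \<Rightarrow> 'j set \<Rightarrow> 'v set set" where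
  "choice_sets h I J = (\<lambda>F. (\<lambda>i. h i (F i)) ` I) ` (I \<rightarrow>\<^sub>E J)"

lemma finite_choice_sets: "finite I \<Longrightarrow> finite J \<Longrightarrow> finite (choice_sets h I J)"
  by (simp add: choice_sets_def finite_PiE)

lemma finite_in_choice_sets: "finite I \<Longrightarrow> S \<in> choice_sets h I J \<Longrightarrow> finite S"
  by (auto simp: choice_sets_def)

text \<open>Distributivity turns the product into a sum over choice functions. Since
  \<open>h\<close> determines both of its indices, different choice functions select different
  sets.\<close>

lemma prod_sum_var_poly:
  assumes "finite I" "finite J"
    and h: "\<And>i j i' j'. h i j = h i' j' \<Longrightarrow> i = i' \<and> j = j'"
  shows "(\<Prod>i\<in>I. \<Sum>j\<in>J. var_poly (h i j)) = family_poly (choice_sets h I J)"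
proof -
  have "(\<Prod>i\<in>I. \<Sum>j\<in>J. var_poly (h i j)) = (\<Sum>F\<in>I \<rightarrow>\<^sub>E J. \<Prod>i\<in>I. var_poly (h i (F i)))"
    using assms by (subst prod_sum_PiE) auto
  also have "\<dots> = family_poly (choice_sets h I J)"
    unfolding choice_sets_def
  proof (rule sum_prod_var_poly_eq_family_poly)
    show "inj_on (\<lambda>i. h i (F i)) I" for F
      by (rule inj_onI) (use h in blast)
    show "inj_on (\<lambda>F. (\<lambda>i. h i (F i)) ` I) (I \<rightarrow>\<^sub>E J)"
    proof (rule inj_onI)
      fix F G
      assume F: "F \<in> I \<rightarrow>\<^sub>E J" and G: "G \<in> I \<rightarrow>\<^sub>E J"
        and eq: "(\<lambda>i. h i (F i)) ` I = (\<lambda>i. h i (G i)) ` I"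
      show "F = G"
      proof (rule PiE_ext[OF F G])
        fix i assume "i \<in> I"
        \<comment> \<open>This element is \<open>h k (G k)\<close> for some \<open>k\<close>, and
          injectivity of \<open>h\<close> forces \<open>k = i\<close>.\<close>
        then have "h i (F i) \<in> (\<lambda>i. h i (G i)) ` I"
          using eq by blast
        then show "F i = G i"
          using h by blast
      qed
    qed
  qed
  finally show ?thesis .
qed

section \<open>Permutations as common row and column choices\<close>

text \<open>A choice by rows consists of pairs \<open>(i, F i)\<close>, a choice by columns of pairs
  \<open>(G j, j)\<close>. If they agree, \<open>G\<close> undoes \<open>F\<close>, so
  \<open>F\<close> is injective and, \<open>I\<close> being finite, bijective. Conversely, a
  permutation and its inverse supply the two choices.\<close>

lemma choice_sets_rows_columns:
  assumes "finite I"
  shows "choice_sets Pair I I \<inter> choice_sets (\<lambda>j i. (i, j)) I I =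
    (\<lambda>\<sigma>. (\<lambda>i. (i, \<sigma> i)) ` I) ` {\<sigma>. \<sigma> permutes I}"
proof (intro equalityI subsetI)
  fix S assume "S \<in> choice_sets Pair I I \<inter> choice_sets (\<lambda>j i. (i, j)) I I"
  then obtain F G where F: "F \<in> I \<rightarrow>\<^sub>E I" "S = (\<lambda>i. (i, F i)) ` I"
    and G: "G \<in> I \<rightarrow>\<^sub>E I" "S = (\<lambda>j. (G j, j)) ` I"
    unfolding choice_sets_def by blast
  \<comment> \<open>\<open>F\<close> is \<open>undefined\<close> off \<open>I\<close>, whereas a
    permutation of \<open>I\<close> must be the identity there.\<close>
  define \<sigma> where "\<sigma> = (\<lambda>i. if i \<in> I then F i else i)"
  have "G (F i) = i" if "i \<in> I" for i
  proof -
    have "(i, F i) \<in> (\<lambda>j. (G j, j)) ` I"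
      using that F(2) G(2) by blast
    then show ?thesis by auto
  qed
  then have "inj_on F I"
    by (rule inj_on_inverseI)
  moreover have "F ` I \<subseteq> I"
    using F(1) by auto
  ultimately have "bij_betw F I I"
    by (simp add: bij_betw_def assms endo_inj_surj)
  then have "bij_betw \<sigma> I I"
    by (subst bij_betw_cong[where g = F]) (simp_all add: \<sigma>_def)
  then have "\<sigma> permutes I"
    by (rule bij_imp_permutes) (simp add: \<sigma>_def)
  moreover have "S = (\<lambda>i. (i, \<sigma> i)) ` I"
    unfolding F(2) \<sigma>_def by (rule image_cong) simp_all
  ultimately show "S \<in> (\<lambda>\<sigma>. (\<lambda>i. (i, \<sigma> i)) ` I) ` {\<sigma>. \<sigma> permutes I}"
    by blast
next
  fix S assume "S \<in> (\<lambda>\<sigma>. (\<lambda>i. (i, \<sigma> i)) ` I) ` {\<sigma>. \<sigma> permutes I}"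
  then obtain \<sigma> where \<sigma>: "\<sigma> permutes I" and S: "S = (\<lambda>i. (i, \<sigma> i)) ` I"
    by blast
  \<comment> \<open>\<open>choice_sets\<close> ranges over extensional functions, so
    \<open>\<sigma>\<close> and its inverse are restricted to \<open>I\<close>.\<close>
  have rows: "S = (\<lambda>i. (i, restrict \<sigma> I i)) ` I"
    unfolding S by (rule image_cong) simp_all
  \<comment> \<open>The same graph is now indexed by its second coordinate
    \<open>j = \<sigma> i\<close>.\<close>
  have "S = (\<lambda>j. (inv \<sigma> j, j)) ` \<sigma> ` I"
    unfolding S image_image by (simp add: permutes_inverses(2)[OF \<sigma>])
  also have "\<dots> = (\<lambda>j. (restrict (inv \<sigma>) I j, j)) ` I"
    unfolding permutes_image[OF \<sigma>] by (rule image_cong) simp_all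
  finally have columns: "S = (\<lambda>j. (restrict (inv \<sigma>) I j, j)) ` I" .
  have "restrict \<sigma> I \<in> I \<rightarrow>\<^sub>E I" "restrict (inv \<sigma>) I \<in> I \<rightarrow>\<^sub>E I"
    using permutes_in_image[OF \<sigma>] permutes_in_image[OF permutes_inv[OF \<sigma>]] by auto
  then show "S \<in> choice_sets Pair I I \<inter> choice_sets (\<lambda>j i. (i, j)) I I"
    unfolding choice_sets_def using rows columns by blast
qed

text \<open>A permutation of \<open>{1..n}\<close> is determined by its graph there, being the
  identity elsewhere, so the terms of the permanent are distinct squarefree monomials.\<close>

lemma permanent_poly_eq_family_poly:
  "permanent_poly n =
    family_poly ((\<lambda>\<sigma>. (\<lambda>i. (i, \<sigma> i)) ` {1..n}) ` {\<sigma>. \<sigma> permutes {1..n}})"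
  unfolding permanent_poly_def
proof (rule sum_prod_var_poly_eq_family_poly)
  show "inj_on (\<lambda>i. (i, \<sigma> i)) {1..n}" for \<sigma> :: "nat \<Rightarrow> nat"
    by (rule inj_onI) simp
  show "inj_on (\<lambda>\<sigma>. (\<lambda>i. (i, \<sigma> i)) ` {1..n}) {\<sigma>. \<sigma> permutes {1..n}}"
  proof (rule inj_onI)
    fix \<sigma> \<tau>
    assume \<sigma>: "\<sigma> \<in> {\<sigma>. \<sigma> permutes {1..n}}" and \<tau>: "\<tau> \<in> {\<sigma>. \<sigma> permutes {1..n}}"
      and eq: "(\<lambda>i. (i, \<sigma> i)) ` {1..n} = (\<lambda>i. (i, \<tau> i)) ` {1..n}"
    show "\<sigma> = \<tau>"
    proof
      fix i
      show "\<sigma> i = \<tau> i"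
      proof (cases "i \<in> {1..n}")
        case True
        then have "(i, \<sigma> i) \<in> (\<lambda>i. (i, \<tau> i)) ` {1..n}"
          using eq by blast
        then show ?thesis by auto
      next
        case False
        then show ?thesis
          using \<sigma> \<tau> by (metis mem_Collect_eq permutes_not_in)
      qed
    qed
  qed
qed

section \<open>Formulas for the row and column products\<close>

text \<open>The neutral constant closes the fold and covers the empty list, at the price of one
  extra leaf and one extra gate for a nonempty list.\<close>

definition sum_formula :: "('v, 'a::zero) formula list \<Rightarrow> ('v, 'a) formula" where
  "sum_formula \<phi>s = foldr Plus \<phi>s (Const 0)"

definition prod_formula :: "('v, 'a::one) formula list \<Rightarrow> ('v, 'a) formula" where
  "prod_formula \<phi>s = foldr Times \<phi>s (Const 1)"

lemma formula_poly_sum_formula: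
  "formula_poly (sum_formula \<phi>s) = sum_list (map formula_poly \<phi>s)"
  by (induction \<phi>s) (simp_all add: sum_formula_def const_poly_def)

lemma formula_poly_prod_formula:
  "formula_poly (prod_formula \<phi>s) = prod_list (map formula_poly \<phi>s)"
  by (induction \<phi>s) (simp_all add: prod_formula_def const_poly_def)

lemma formula_size_sum_formula:
  "formula_size (sum_formula \<phi>s) = 1 + (\<Sum>\<phi>\<leftarrow>\<phi>s. 1 + formula_size \<phi>)"
  by (induction \<phi>s) (simp_all add: sum_formula_def)

lemma formula_size_prod_formula:
  "formula_size (prod_formula \<phi>s) = 1 + (\<Sum>\<phi>\<leftarrow>\<phi>s. 1 + formula_size \<phi>)"
  by (induction \<phi>s) (simp_all add: prod_formula_def)

lemma formula_vars_sum_formula: "formula_vars (sum_formula \<phi>s) = (\<Union>\<phi>\<in>set \<phi>s. formula_vars \<phi>)"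
  by (induction \<phi>s) (simp_all add: sum_formula_def)

lemma formula_vars_prod_formula: "formula_vars (prod_formula \<phi>s) = (\<Union>\<phi>\<in>set \<phi>s. formula_vars \<phi>)"
  by (induction \<phi>s) (simp_all add: prod_formula_def)

lemma formula_consts_sum_formula:
  "formula_consts (sum_formula \<phi>s) = insert 0 (\<Union>\<phi>\<in>set \<phi>s. formula_consts \<phi>)"
  by (induction \<phi>s) (auto simp: sum_formula_def)

lemma formula_consts_prod_formula:
  "formula_consts (prod_formula \<phi>s) = insert 1 (\<Union>\<phi>\<in>set \<phi>s. formula_consts \<phi>)"
  by (induction \<phi>s) (auto simp: prod_formula_def)

text \<open>When \<open>h\<close> is injective in both indices, each of the n^2 variables labels
  exactly one leaf, which is why the size is quadratic.\<close>

definition line_formula :: "(nat \<Rightarrow> nat \<Rightarrow> 'v) \<Rightarrow> nat \<Rightarrow> ('v, 'a::zero_neq_one) formula" where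
  "line_formula h n =
    prod_formula (map (\<lambda>i. sum_formula (map (\<lambda>j. Var (h i j)) [1..<Suc n])) [1..<Suc n])"

lemma formula_poly_line_formula:
  "formula_poly (line_formula h n) = (\<Prod>i=1..n. \<Sum>j=1..n. var_poly (h i j))"
  by (simp only: line_formula_def formula_poly_prod_formula formula_poly_sum_formula map_map o_def
      formula_poly.simps prod.distinct_set_conv_list[symmetric] sum.distinct_set_conv_list[symmetric]
      distinct_upt set_upt atLeastLessThanSuc_atLeastAtMost)

lemma formula_size_line_formula:
  assumes "n \<ge> 1"
  shows "formula_size (line_formula h n :: ('v, 'a::zero_neq_one) formula) \<le> 5 * n\<^sup>2"
proof -
  \<comment> \<open>A line sum has n variables, n gates and one constant, so size 2n + 1. The
    product adds a gate for each of the n lines and a final constant: n(2n + 2) + 1.\<close>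
  have "formula_size (line_formula h n :: ('v, 'a) formula) = 1 + 2 * n + 2 * n\<^sup>2"
    by (simp add: line_formula_def formula_size_prod_formula formula_size_sum_formula o_def
        sum_list_triv power2_eq_square algebra_simps del: upt_Suc)
  \<comment> \<open>Bounding 1 and n by n^2 gives the coefficient 1 + 2 + 2 = 5.\<close>
  moreover have "1 \<le> n\<^sup>2" "n \<le> n\<^sup>2"
    using assms by (simp_all add: power2_eq_square)
  ultimately show ?thesis by linarith
qed

lemma formula_vars_line_formula:
  "formula_vars (line_formula h n) = (\<Union>i\<in>{1..n}. \<Union>j\<in>{1..n}. {h i j})"
  by (simp add: line_formula_def formula_vars_prod_formula formula_vars_sum_formula
      atLeastLessThanSuc_atLeastAtMost del: upt_Suc)

lemma formula_consts_line_formula: "formula_consts (line_formula h n) \<subseteq> {0, 1}"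
  by (auto simp: line_formula_def formula_consts_prod_formula formula_consts_sum_formula)

section \<open>The permanent as a Hadamard product\<close>

text \<open>Working over any commutative semiring with constants confined to 0 and 1 lets one
  construction serve every field and also give monotonicity over the rationals.\<close>

lemma permanent_poly_hadamard_formulas:
  assumes "n \<ge> 1"
  obtains \<phi> \<psi> :: "(nat \<times> nat, 'a::comm_semiring_1) formula"
  where "poly_vars (formula_poly \<phi>) \<subseteq> index_square n" "poly_vars (formula_poly \<psi>) \<subseteq> index_square n"
    "multilinear (formula_poly \<phi>)" "multilinear (formula_poly \<psi>)"
    "formula_vars \<phi> \<subseteq> index_square n" "formula_size \<phi> \<le> 5 * n\<^sup>2" "formula_consts \<phi> \<subseteq> {0, 1}"
    "formula_vars \<psi> \<subseteq> index_square n" "formula_size \<psi> \<le> 5 * n\<^sup>2" "formula_consts \<psi> \<subseteq> {0, 1}"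
    "formula_poly \<phi> \<circ>\<^sub>H formula_poly \<psi> = permanent_poly n"
proof (rule that)
  let ?\<phi> = "line_formula Pair n :: (_, 'a) formula"
  let ?\<psi> = "line_formula (\<lambda>j i. (i, j)) n :: (_, 'a) formula"
  define A where "A = choice_sets Pair {1..n} {1..n}"
  define B where "B = choice_sets (\<lambda>j i. (i, j)) {1..n} {1..n}"
  have fin: "finite A" "finite B" "\<And>S. S \<in> A \<Longrightarrow> finite S" "\<And>S. S \<in> B \<Longrightarrow> finite S"
    by (auto simp: A_def B_def finite_choice_sets dest: finite_in_choice_sets[rotated])
  have \<phi>: "formula_poly ?\<phi> = family_poly A"
    unfolding formula_poly_line_formula A_def by (rule prod_sum_var_poly) auto
  have \<psi>: "formula_poly ?\<psi> = family_poly B"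
    unfolding formula_poly_line_formula B_def by (rule prod_sum_var_poly) auto
  have "\<Union>A \<subseteq> index_square n" "\<Union>B \<subseteq> index_square n"
    by (auto simp: A_def B_def choice_sets_def index_square_def dest!: PiE_mem)
  then show "poly_vars (formula_poly ?\<phi>) \<subseteq> index_square n"
    "poly_vars (formula_poly ?\<psi>) \<subseteq> index_square n"
    by (simp_all add: \<phi> \<psi> poly_vars_family_poly fin)
  show "multilinear (formula_poly ?\<phi>)" "multilinear (formula_poly ?\<psi>)"
    by (simp_all add: \<phi> \<psi> multilinear_family_poly fin)
  show "formula_vars ?\<phi> \<subseteq> index_square n" "formula_vars ?\<psi> \<subseteq> index_square n"
    by (auto simp: formula_vars_line_formula index_square_def)
  show "formula_size ?\<phi> \<le> 5 * n\<^sup>2" "formula_size ?\<psi> \<le> 5 * n\<^sup>2"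
    by (rule formula_size_line_formula[OF assms])+
  show "formula_consts ?\<phi> \<subseteq> {0, 1}" "formula_consts ?\<psi> \<subseteq> {0, 1}"
    by (rule formula_consts_line_formula)+
  \<comment> \<open>The sets in \<open>A \<inter> B\<close> meet each row once and each column once,
    so they are the supports of permutation matrices.\<close>
  have "permanent_poly n = (family_poly (A \<inter> B) :: (_, 'a) mpoly)"
    by (simp only: permanent_poly_eq_family_poly A_def B_def
        choice_sets_rows_columns[OF finite_atLeastAtMost])
  moreover have "family_poly A \<circ>\<^sub>H family_poly B = (family_poly (A \<inter> B) :: (_, 'a) mpoly)"
    by (rule hadamard_family_poly) (use fin in auto)
  ultimately show "formula_poly ?\<phi> \<circ>\<^sub>H formula_poly ?\<psi> = permanent_poly n"
    by (simp only: \<phi> \<psi>)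
qed

theorem proposition4:
  "(\<exists>C::nat. \<forall>n\<ge>1. \<exists>f g :: (nat \<times> nat, 'a::field) mpoly.
      poly_vars f \<subseteq> index_square n \<and> poly_vars g \<subseteq> index_square n \<and>
      multilinear f \<and> multilinear g \<and>
      (\<exists>\<phi>. formula_vars \<phi> \<subseteq> index_square n \<and> formula_poly \<phi> = f \<and> formula_size \<phi> \<le> C * n\<^sup>2) \<and>
      (\<exists>\<psi>. formula_vars \<psi> \<subseteq> index_square n \<and> formula_poly \<psi> = g \<and> formula_size \<psi> \<le> C * n\<^sup>2) \<and>
      f \<circ>\<^sub>H g = permanent_poly n)
   \<and>
   (\<exists>C::nat. \<forall>n\<ge>1. \<exists>f g :: (nat \<times> nat, rat) mpoly.
      poly_vars f \<subseteq> index_square n \<and> poly_vars g \<subseteq> index_square n \<and>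
      multilinear f \<and> multilinear g \<and>
      (\<exists>\<phi>. formula_vars \<phi> \<subseteq> index_square n \<and> formula_poly \<phi> = f \<and> formula_size \<phi> \<le> C * n\<^sup>2 \<and>
           monotone_formula \<phi>) \<and>
      (\<exists>\<psi>. formula_vars \<psi> \<subseteq> index_square n \<and> formula_poly \<psi> = g \<and> formula_size \<psi> \<le> C * n\<^sup>2 \<and>
           monotone_formula \<psi>) \<and>
      f \<circ>\<^sub>H g = permanent_poly n)"
\<comment> \<open>The constant 5 is the one in \<open>formula_size_line_formula\<close>; it depends
  neither on n nor on the coefficients.\<close>
proof ((rule conjI; rule exI[of _ 5]; intro allI impI), goal_cases)
  case (1 n)
  show ?case
    by (rule permanent_poly_hadamard_formulas[OF 1, where ?'a = 'a], (rule exI)+, intro conjI)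
      (assumption | rule exI conjI refl)+
next
  case (2 n)
  \<comment> \<open>Both admissible constants, 0 and 1, are nonnegative.\<close>
  have mono: "monotone_formula \<phi>" if "formula_consts \<phi> \<subseteq> {0, 1}"
    for \<phi> :: "(nat \<times> nat, rat) formula"
    using that by (auto simp: monotone_formula_def)
  show ?case
    by (rule permanent_poly_hadamard_formulas[OF 2, where ?'a = rat], (rule exI)+, intro conjI)
      (assumption | rule exI conjI refl | erule mono)+
qed

end
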